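(* Let $G$ be a finite group of order $N$ acting unitarily on the $d$-dimensional real inner product space $\mathcal{V}$. Assume that, for fixed $S\subset[N]\times[p]$, $|S|=m$, and $\mathbf{w}=(w_1,\dots,w_p)\in\mathcal{V}^p$, the map $\widehat{\Phi}_{\mathbf{w},S}:\widehat{\mathcal{V}}\to\mathbb{R}^m$ is bi-Lipschitz on the quotient space $\widehat{\mathcal{V}}=\mathcal{V}/G$. Let $L$ be a locally convex topological vector space. For every continuous map $F:\widehat{\mathcal{V}}\to L$ there exists a continuous $T:\mathbb{R}^m\to L$ such that $F=T\circ\Phi_{\mathbf{w},S}$ (i.e. $F([x])=T(\Phi_{\mathbf{w},S}(x))$ for all $x\in\mathcal{V}$). Furthermore, $T(\mathbb{R}^m)$ is included in the convex hull of $F(\widehat{\mathcal{V}})$.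
   Context: $(\mathcal{V},\langle\cdot,\cdot\rangle)$ is a real inner product space of finite dimension $d\ge 2$, and $G$ ($|G|=N$) acts unitarily: $g\mapsto U_g$ is a homomorphism into the group of linear isometries of $\mathcal{V}$. The orbit of $x$ is $[x]=\{U_gx:g\in G\}$, $\widehat{\mathcal{V}}=\mathcal{V}/G$ is the set of orbits, with metric $\mathbf{d}([x],[y])=\min_{g\in G}\|x-U_gy\|$; continuity on $\widehat{\mathcal{V}}$ is with respect to $\mathbf{d}$. For $n\in\mathbb{N}$, $[n]=\{1,\dots,n\}$. For $i\in[p]$ and $j\in[N]$, $\Phi_{w_i,j}(x)$ is the $j$-th coordinate of the vector obtained by sorting the $N$ numbers $(\langle U_gw_i,x\rangle)_{g\in G}$ (with repetitions) in decreasing order. With $S_i=\{k\in[N]:(k,i)\in S\}$, the coorbit embedding is $$\Phi_{\mathbf{w},S}:\mathcal{V}\to\mathbb{R}^m,\qquad \Phi_{\mathbf{w},S}(x)=\big[\{\Phi_{w_1,j}(x)\}_{j\in S_1},\dots,\{\Phi_{w_p,j}(x)\}_{j\in S_p}\big].$$ It is $G$-invariant, and $\widehat{\Phi}_{\mathbf{w},S}([x])=\Phi_{\mathbf{w},S}(x)$ is the induced map on $\widehat{\mathcal{V}}$. Bi-Lipschitz means there are $0<a\le b<\infty$ with $a\,\mathbf{d}([x],[y])\le\|\Phi_{\mathbf{w},S}(x)-\Phi_{\mathbf{w},S}(y)\|_2\le b\,\mathbf{d}([x],[y])$ for all $x,y\in\mathcal{V}$. *)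

theory Defs
  imports "HOL-Analysis.Analysis" "HOL-Algebra.Group_Action" "HOL-Library.Multiset"
begin

section \<open>Locally convex topological vector spaces\<close>

text \<open>No separation axiom is assumed. Local convexity says that \<open>0\<close> has a neighbourhood base of
  convex, not necessarily open, sets. A complex locally convex space is one by restriction of
  scalars. The convexity of \<open>C\<close> is \<^const>\<open>convex\<close> written out, since its sort constraint is not
  admitted inside a class specification (see \<open>convex_nhds_zero\<close> below).\<close>

class topological_real_vector = real_vector + topological_ab_group_add +
  assumes tendsto_scaleR_nhds:
    "LIM z (nhds (c :: real) \<times>\<^sub>F nhds a). fst z *\<^sub>R snd z :> nhds (c *\<^sub>R a)"

class locally_convex_space = topological_real_vector +
  assumes convex_nhds_0:
    "open W \<Longrightarrow> 0 \<in> W \<Longrightarrow>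
      \<exists>C V. (\<forall>x\<in>C. \<forall>y\<in>C. \<forall>s\<ge>0. \<forall>t\<ge>0. s + t = 1 \<longrightarrow> s *\<^sub>R x + t *\<^sub>R y \<in> C) \<and>
            open V \<and> 0 \<in> V \<and> V \<subseteq> C \<and> C \<subseteq> W"

lemma convex_nhds_zero:
  fixes W :: "'a::locally_convex_space set"
  assumes "open W" "0 \<in> W"
  shows "\<exists>C V. convex C \<and> open V \<and> 0 \<in> V \<and> V \<subseteq> C \<and> C \<subseteq> W"
  unfolding convex_def by (rule convex_nhds_0[OF assms])

instance real_normed_vector \<subseteq> topological_real_vector
proof
  fix c :: real and a :: 'a
  show "LIM z (nhds c \<times>\<^sub>F nhds a). fst z *\<^sub>R snd z :> nhds (c *\<^sub>R a)"
    by (intro tendsto_scaleR filterlim_fst filterlim_snd)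
qed

instance real_normed_vector \<subseteq> locally_convex_space
proof
  fix W :: "'a set"
  assume "open W" "0 \<in> W"
  then obtain e where "e > 0" "ball 0 e \<subseteq> W"
    using openE by blast
  then have "\<exists>C V. convex C \<and> open V \<and> 0 \<in> V \<and> V \<subseteq> C \<and> C \<subseteq> W"
    by (intro exI[of _ "ball 0 e"]) auto
  then show "\<exists>C V. (\<forall>x\<in>C. \<forall>y\<in>C. \<forall>s\<ge>0. \<forall>t\<ge>0. s + t = 1 \<longrightarrow> s *\<^sub>R x + t *\<^sub>R y \<in> C) \<and>
      open V \<and> 0 \<in> V \<and> V \<subseteq> C \<and> C \<subseteq> W"
    unfolding convex_def .
qed


section \<open>Unitary actions and the quotient metric\<close>

definition linear_isometry_group :: "('v::euclidean_space \<Rightarrow> 'v) monoid" where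
  "linear_isometry_group =
     \<lparr>carrier = {f. orthogonal_transformation f}, mult = (\<circ>), one = id\<rparr>"

definition unitary_action ::
    "('g, 'b) monoid_scheme \<Rightarrow> ('g \<Rightarrow> 'v::euclidean_space \<Rightarrow> 'v) \<Rightarrow> bool" where
  "unitary_action G U \<longleftrightarrow> group G \<and> U \<in> hom G linear_isometry_group"

abbreviation quotient_space ::
    "('g, 'b) monoid_scheme \<Rightarrow> ('g \<Rightarrow> 'v::euclidean_space \<Rightarrow> 'v) \<Rightarrow> 'v set set" where
  "quotient_space G U \<equiv> orbits G UNIV U"

text \<open>The minimum does not depend on the representatives \<open>x \<in> A\<close>, \<open>y \<in> B\<close>, so that \<^const>\<open>the_elem\<close>
  picks its common value (see \<open>quotient_dist_orbit\<close> below). The value \<open>0\<close> off the quotient space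
  is a dummy: \<^locale>\<open>Metric_space\<close> wants nonnegativity and symmetry for all arguments.\<close>

definition quotient_dist ::
    "('g, 'b) monoid_scheme \<Rightarrow> ('g \<Rightarrow> 'v::euclidean_space \<Rightarrow> 'v) \<Rightarrow> 'v set \<Rightarrow> 'v set \<Rightarrow> real" where
  "quotient_dist G U A B =
     (if A \<in> quotient_space G U \<and> B \<in> quotient_space G U
      then the_elem ((\<lambda>(x, y). MIN g\<in>carrier G. norm (x - U g y)) ` (A \<times> B))
      else 0)"

definition quotient_topology ::
    "('g, 'b) monoid_scheme \<Rightarrow> ('g \<Rightarrow> 'v::euclidean_space \<Rightarrow> 'v) \<Rightarrow> 'v set topology" where
  "quotient_topology G U = Metric_space.mtopology (quotient_space G U) (quotient_dist G U)"


section \<open>The coorbit embedding\<close>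

text \<open>Lists are indexed from \<open>0\<close>, whereas \<open>j\<close> ranges over \<open>{1..order G}\<close>.\<close>

definition sorted_coorbit ::
    "('g, 'b) monoid_scheme \<Rightarrow> ('g \<Rightarrow> 'v::euclidean_space \<Rightarrow> 'v) \<Rightarrow> 'v \<Rightarrow> nat \<Rightarrow> 'v \<Rightarrow> real" where
  "sorted_coorbit G U w j x =
     rev (sorted_list_of_multiset (image_mset (\<lambda>g. U g w \<bullet> x) (mset_set (carrier G)))) ! (j - 1)"

text \<open>The coordinates of \<open>\<real>\<^sup>m\<close> are listed by a bijection \<open>e\<close> from the index type of size \<open>m\<close> onto
  the set \<open>S\<close> of pairs \<open>(j, i)\<close>. Ordering the pairs by \<open>i\<close> first and then by \<open>j\<close> gives the
  concatenated vector \<open>[{\<Phi>\<^bsub>w1,j\<^esub>(x)}\<^bsub>j\<in>S1\<^esub>, \<dots>, {\<Phi>\<^bsub>wp,j\<^esub>(x)}\<^bsub>j\<in>Sp\<^esub>]\<close>.\<close>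

definition coorbit ::
    "('g, 'b) monoid_scheme \<Rightarrow> ('g \<Rightarrow> 'v::euclidean_space \<Rightarrow> 'v) \<Rightarrow> (nat \<Rightarrow> 'v) \<Rightarrow>
     ('m::finite \<Rightarrow> nat \<times> nat) \<Rightarrow> 'v \<Rightarrow> real ^ 'm" where
  "coorbit G U w e x = (\<chi> k. case e k of (j, i) \<Rightarrow> sorted_coorbit G U (w i) j x)"

definition coorbit_quotient ::
    "('g, 'b) monoid_scheme \<Rightarrow> ('g \<Rightarrow> 'v::euclidean_space \<Rightarrow> 'v) \<Rightarrow> (nat \<Rightarrow> 'v) \<Rightarrow>
     ('m::finite \<Rightarrow> nat \<times> nat) \<Rightarrow> 'v set \<Rightarrow> real ^ 'm" where
  "coorbit_quotient G U w e A = the_elem (coorbit G U w e ` A)"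

definition bi_lipschitz_on :: "'a set \<Rightarrow> ('a \<Rightarrow> 'a \<Rightarrow> real) \<Rightarrow> ('a \<Rightarrow> 'c::metric_space) \<Rightarrow> bool" where
  "bi_lipschitz_on M d f \<longleftrightarrow>
     (\<exists>a b. 0 < a \<and> a \<le> b \<and>
        (\<forall>A\<in>M. \<forall>B\<in>M. a * d A B \<le> dist (f A) (f B) \<and> dist (f A) (f B) \<le> b * d A B))"


section \<open>Independence of representatives\<close>

lemma image_eq_singletonI:
  assumes "\<And>x. x \<in> A \<Longrightarrow> f x = c" "A \<noteq> {}"
  shows "f ` A = {c}"
  using assms by (auto simp: image_iff)

lemma unitary_actionD:
  fixes G (structure)
  assumes "unitary_action G U" "g \<in> carrier G" "h \<in> carrier G"
  shows "U (g \<otimes>\<^bsub>G\<^esub> h) x = U g (U h x)" and "linear (U g)" and "norm (U g x) = norm x"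
    and "U g x \<bullet> U g y = x \<bullet> y"
  using assms
  by (auto simp: unitary_action_def hom_def linear_isometry_group_def orthogonal_transformation
      Pi_iff)
     (simp add: orthogonal_transformation[symmetric] orthogonal_transformation_def)

lemma unitary_action_one:
  fixes G (structure)
  assumes "unitary_action G U"
  shows "U \<one>\<^bsub>G\<^esub> x = x"
proof -
  interpret group G using assms by (simp add: unitary_action_def)
  have "U \<one>\<^bsub>G\<^esub> (U \<one>\<^bsub>G\<^esub> x) = U \<one>\<^bsub>G\<^esub> x"
    using unitary_actionD(1)[OF assms one_closed one_closed, of x] by simp
  then have "norm (U \<one>\<^bsub>G\<^esub> (U \<one>\<^bsub>G\<^esub> x - x)) = 0"
    using linear_diff[OF unitary_actionD(2)[OF assms one_closed one_closed]] by simp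
  then show ?thesis
    using unitary_actionD(3)[OF assms one_closed one_closed] by simp
qed

lemma unitary_action_dist:
  fixes G (structure)
  assumes "unitary_action G U" "g \<in> carrier G"
  shows "norm (U g x - U g y) = norm (x - y)"
  by (metis assms linear_diff unitary_actionD(2,3))

lemma (in group) mult_image_carrier:
  assumes "h \<in> carrier G"
  shows "(\<lambda>g. g \<otimes> h) ` carrier G = carrier G" "(\<lambda>g. h \<otimes> g) ` carrier G = carrier G"
proof -
  have "g \<in> (\<lambda>g. g \<otimes> h) ` carrier G" if "g \<in> carrier G" for g
    using that assms by (intro image_eqI[of _ _ "g \<otimes> inv h"]) (auto simp: m_assoc)
  then show "(\<lambda>g. g \<otimes> h) ` carrier G = carrier G"
    using assms by auto
  show "(\<lambda>g. h \<otimes> g) ` carrier G = carrier G"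
    using assms by (rule surj_const_mult)
qed

lemma quotient_dist_aux:
  fixes G (structure)
  assumes "unitary_action G U" "h \<in> carrier G" "k \<in> carrier G"
  shows "(\<lambda>g. norm (U h x - U g (U k y))) ` carrier G = (\<lambda>g. norm (x - U g y)) ` carrier G"
proof -
  interpret group G using assms by (simp add: unitary_action_def)
  have *: "norm (U h x - U (h \<otimes> g) (U k y)) = norm (x - U (g \<otimes> k) y)" if "g \<in> carrier G" for g
    using that assms
    by (simp add: unitary_actionD(1)[OF assms(1)] unitary_action_dist[OF assms(1)])
  have "(\<lambda>g. norm (U h x - U g (U k y))) ` carrier G
      = (\<lambda>g. norm (U h x - U g (U k y))) ` (\<lambda>g. h \<otimes> g) ` carrier G"
    using mult_image_carrier(2)[OF assms(2)] by simp
  also have "\<dots> = (\<lambda>g. norm (x - U (g \<otimes> k) y)) ` carrier G"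
    by (simp add: image_image * cong: image_cong_simp)
  also have "\<dots> = (\<lambda>g. norm (x - U g y)) ` (\<lambda>g. g \<otimes> k) ` carrier G"
    by (simp add: image_image)
  finally show ?thesis
    using mult_image_carrier(1)[OF assms(3)] by simp
qed

lemma quotient_dist_orbit:
  fixes G (structure)
  assumes "unitary_action G U"
  shows "quotient_dist G U (orbit G U x) (orbit G U y) = (MIN g\<in>carrier G. norm (x - U g y))"
proof -
  interpret group G using assms by (simp add: unitary_action_def)
  have "(\<lambda>(x, y). MIN g\<in>carrier G. norm (x - U g y)) ` (orbit G U x \<times> orbit G U y)
      = {MIN g\<in>carrier G. norm (x - U g y)}"
  proof -
    have "(MIN g\<in>carrier G. norm (a - U g b)) = (MIN g\<in>carrier G. norm (x - U g y))"
      if "a \<in> orbit G U x" "b \<in> orbit G U y" for a b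
      using that quotient_dist_aux[OF assms] by (auto simp: orbit_def)
    moreover have "orbit G U x \<noteq> {}" "orbit G U y \<noteq> {}"
      by (auto simp: orbit_def)
    ultimately show ?thesis
      by (intro image_eq_singletonI) auto
  qed
  then show ?thesis
    by (auto simp: quotient_dist_def orbits_def)
qed

lemma sorted_coorbit_invariant:
  fixes G (structure)
  assumes "unitary_action G U" "h \<in> carrier G"
  shows "sorted_coorbit G U w j (U h x) = sorted_coorbit G U w j x"
proof -
  interpret group G using assms by (simp add: unitary_action_def)
  have inj: "inj_on (\<lambda>g. h \<otimes> g) (carrier G)"
    using assms(2) by (auto simp: inj_on_def)
  have "image_mset (\<lambda>g. U g w \<bullet> U h x) (mset_set (carrier G))
      = image_mset (\<lambda>g. U g w \<bullet> U h x) (mset_set ((\<lambda>g. h \<otimes> g) ` carrier G))"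
    using mult_image_carrier(2)[OF assms(2)] by simp
  also have "\<dots> = image_mset (\<lambda>g. U (h \<otimes> g) w \<bullet> U h x) (mset_set (carrier G))"
    by (simp add: image_mset_mset_set[OF inj, symmetric] multiset.map_comp o_def)
  also have "\<dots> = image_mset (\<lambda>g. U g w \<bullet> x) (mset_set (carrier G))"
  proof (cases "finite (carrier G)")
    case True
    then show ?thesis
      using assms(2)
      by (intro image_mset_cong)
         (simp add: unitary_actionD(1)[OF assms(1)] unitary_actionD(4)[OF assms(1)])
  qed simp
  finally show ?thesis
    by (simp add: sorted_coorbit_def)
qed

lemma coorbit_quotient_orbit:
  fixes G (structure)
  assumes "unitary_action G U"
  shows "coorbit_quotient G U w e (orbit G U x) = coorbit G U w e x"
proof -
  interpret group G using assms by (simp add: unitary_action_def)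
  have "coorbit G U w e a = coorbit G U w e x" if "a \<in> orbit G U x" for a
    using that sorted_coorbit_invariant[OF assms]
    by (auto simp: orbit_def coorbit_def vec_eq_iff split: prod.split)
  moreover have "orbit G U x \<noteq> {}"
    by (auto simp: orbit_def)
  ultimately have "coorbit G U w e ` orbit G U x = {coorbit G U w e x}"
    by (intro image_eq_singletonI)
  then show ?thesis
    by (simp add: coorbit_quotient_def)
qed

lemma Metric_space_quotient:
  fixes G (structure)
  assumes "unitary_action G U" "finite (carrier G)"
  shows "Metric_space (quotient_space G U) (quotient_dist G U)"
proof -
  interpret group G using assms by (simp add: unitary_action_def)
  let ?d = "\<lambda>x y. quotient_dist G U (orbit G U x) (orbit G U y)"
  note d = quotient_dist_orbit[OF assms(1)]
  have ne: "carrier G \<noteq> {}" by auto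
  have attained: "\<exists>g\<in>carrier G. ?d x y = norm (x - U g y)" for x y
  proof -
    have "?d x y \<in> (\<lambda>g. norm (x - U g y)) ` carrier G"
      unfolding d using assms(2) ne by (intro Min_in) auto
    then show ?thesis by auto
  qed
  have lower: "?d x y \<le> norm (x - U g y)" if "g \<in> carrier G" for x y g
    using that assms(2) by (simp add: d)
  have inv: "U (inv g) (U g x) = x" if "g \<in> carrier G" for g x
    using that unitary_actionD(1)[OF assms(1), of "inv g" g x] unitary_action_one[OF assms(1)]
    by simp
  have nonneg: "0 \<le> ?d x y" for x y
    using attained[of x y] by auto
  have sym_le: "?d y x \<le> ?d x y" for x y
  proof -
    obtain g where g: "g \<in> carrier G" "?d x y = norm (x - U g y)"
      using attained by blast
    have "?d y x \<le> norm (y - U (inv g) x)"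
      using g by (intro lower) simp
    also have "\<dots> = norm (U (inv g) (U g y) - U (inv g) x)"
      using g by (simp add: inv)
    also have "\<dots> = norm (x - U g y)"
      using g by (simp add: unitary_action_dist[OF assms(1)] norm_minus_commute)
    finally show ?thesis using g by simp
  qed
  have triangle: "?d x z \<le> ?d x y + ?d y z" for x y z
  proof -
    obtain g where g: "g \<in> carrier G" "?d x y = norm (x - U g y)"
      using attained by blast
    obtain h where h: "h \<in> carrier G" "?d y z = norm (y - U h z)"
      using attained by blast
    have "?d x z \<le> norm (x - U (g \<otimes> h) z)"
      using g h by (intro lower) simp
    also have "\<dots> = norm ((x - U g y) + (U g y - U g (U h z)))"
      using g h by (simp add: unitary_actionD(1)[OF assms(1)])
    also have "\<dots> \<le> norm (x - U g y) + norm (U g y - U g (U h z))"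
      by (rule norm_triangle_ineq)
    finally show ?thesis
      using g h by (simp add: unitary_action_dist[OF assms(1)])
  qed
  have orbit_eq: "orbit G U (U g x) = orbit G U x" if "g \<in> carrier G" for g x
  proof -
    have "orbit G U (U g x) = (\<lambda>h. U (h \<otimes> g) x) ` carrier G"
      using that by (auto simp: orbit_def unitary_actionD(1)[OF assms(1)])
    also have "\<dots> = (\<lambda>h. U h x) ` (\<lambda>h. h \<otimes> g) ` carrier G"
      by (simp add: image_image)
    also have "\<dots> = orbit G U x"
      using mult_image_carrier(1)[OF that] by (auto simp: orbit_def)
    finally show ?thesis .
  qed
  have zero: "?d x y = 0 \<longleftrightarrow> orbit G U x = orbit G U y" for x y
  proof
    assume "?d x y = 0"
    then show "orbit G U x = orbit G U y"
      using attained[of x y] orbit_eq by auto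
  next
    assume "orbit G U x = orbit G U y"
    then have "?d x y = ?d x x" by simp
    also have "\<dots> \<le> 0"
      using lower[of "\<one>" x x] unitary_action_one[OF assms(1)] by simp
    finally show "?d x y = 0" using nonneg[of x y] by simp
  qed
  show ?thesis
  proof
    fix A B
    show "0 \<le> quotient_dist G U A B"
      using nonneg by (cases "A \<in> quotient_space G U \<and> B \<in> quotient_space G U")
        (auto simp: orbits_def, auto simp: quotient_dist_def orbits_def)
    show "quotient_dist G U A B = quotient_dist G U B A"
      using sym_le by (cases "A \<in> quotient_space G U \<and> B \<in> quotient_space G U")
        (auto simp: orbits_def intro: order.antisym, auto simp: quotient_dist_def orbits_def)
  next
    fix A B assume "A \<in> quotient_space G U" "B \<in> quotient_space G U"
    then show "quotient_dist G U A B = 0 \<longleftrightarrow> A = B"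
      using zero by (auto simp: orbits_def)
  next
    fix A B C
    assume "A \<in> quotient_space G U" "B \<in> quotient_space G U" "C \<in> quotient_space G U"
    then show "quotient_dist G U A C \<le> quotient_dist G U A B + quotient_dist G U B C"
      using triangle by (auto simp: orbits_def)
  qed
qed

end

theory Submission
  imports Defs
begin

text \<open>
  Write \<open>\<Phi>\<close> for the coorbit map. The lower Lipschitz bound makes the induced map on the quotient
  injective with continuous inverse on its range, so \<open>F (orbit G U x) = f (\<Phi> x)\<close> for a continuous \<open>f\<close> on
  \<open>range \<Phi>\<close> (\<open>continuous_map_factor_through_expansive\<close>). What remains is to extend \<open>f\<close> from
  \<open>range \<Phi>\<close> to \<open>\<real>\<^sup>m\<close> with values in the convex hull of its range.

  The set \<open>range \<Phi>\<close> is closed: the orbit of \<open>x\<close> lies at distance \<open>norm x\<close> from the orbit of \<open>0\<close>, so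
  the lower bound also says that \<open>\<Phi>\<close> is coercive; the upper bound makes \<open>\<Phi>\<close> continuous, and a
  coercive continuous map on a finite-dimensional space has closed range
  (\<open>closed_range_if_coercive\<close>).

  The extension is Dugundji's theorem for values in a locally convex space
  (\<open>Dugundji_locally_convex\<close>). Off the closed set \<open>K\<close> one averages values of \<open>f\<close> with a locally
  finite partition of unity, each weight \<open>H W\<close> carrying a point \<open>A W\<close> of \<open>K\<close> whose distance from the
  support of \<open>H W\<close> is controlled by the distance to \<open>K\<close>
  (\<open>Dugundji_partition_of_unity\<close>). As the argument approaches \<open>a \<in> K\<close>, all points \<open>A W\<close> in use
  approach \<open>a\<close>, so the values \<open>f (A W)\<close> enter any prescribed convex neighbourhood of \<open>f a\<close>, and so do
  their convex combinations. This step is where local convexity is essential.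
\<close>


section \<open>Dugundji extension into locally convex spaces\<close>

lemma continuous_on_scaleR_topological_vector:
  fixes c :: "'a::topological_space \<Rightarrow> real" and f :: "'a \<Rightarrow> 'l::topological_real_vector"
  assumes "continuous_on X c" "continuous_on X f"
  shows "continuous_on X (\<lambda>x. c x *\<^sub>R f x)"
proof -
  have "((\<lambda>y. fst (c y, f y) *\<^sub>R snd (c y, f y)) \<longlongrightarrow> c x *\<^sub>R f x) (at x within X)"
    if "x \<in> X" for x
  proof (rule filterlim_compose[OF tendsto_scaleR_nhds])
    show "LIM y (at x within X). (c y, f y) :> nhds (c x) \<times>\<^sub>F nhds (f x)"
      using assms that by (intro filterlim_Pair) (auto simp: continuous_on_def)
  qed
  then show ?thesis
    by (simp add: continuous_on_def)
qed

text \<open>Cover \<open>- K\<close> by balls of radius half the distance of their centre to \<open>K\<close> and refine to a locally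
  finite cover. Within one such ball all distances to \<open>K\<close> are comparable, so a single nearly
  closest point of \<open>K\<close> to the centre serves as \<open>A W\<close> for every point of the ball.\<close>

lemma Dugundji_partition_of_unity:
  fixes K :: "'a::{metric_space,second_countable_topology} set"
  assumes "closed K" "K \<noteq> {}"
  obtains \<C> :: "'a set set" and H :: "'a set \<Rightarrow> 'a \<Rightarrow> real" and A :: "'a set \<Rightarrow> 'a"
  where "\<And>W. W \<in> \<C> \<Longrightarrow> continuous_on (- K) (H W)"
    and "\<And>W x. W \<in> \<C> \<Longrightarrow> x \<notin> K \<Longrightarrow> 0 \<le> H W x"
    and "\<And>x. x \<notin> K \<Longrightarrow> supp_sum (\<lambda>W. H W x) \<C> = 1"
    and "\<And>x. x \<notin> K \<Longrightarrow> \<exists>V. open V \<and> x \<in> V \<and> finite {W \<in> \<C>. \<exists>y\<in>V. H W y \<noteq> 0}"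
    and "\<And>W. W \<in> \<C> \<Longrightarrow> A W \<in> K"
    and "\<And>W x. W \<in> \<C> \<Longrightarrow> x \<notin> K \<Longrightarrow> H W x \<noteq> 0 \<Longrightarrow> dist x (A W) \<le> 4 * infdist x K"
proof -
  have pos: "0 < infdist x K" if "x \<notin> K" for x
    using assms that infdist_pos_not_in_closed by blast
  define \<B> where "\<B> = (\<lambda>v. ball v (infdist v K / 2)) ` (- K)"
  have \<B>_cover: "- K \<subseteq> \<Union>\<B>"
  proof
    fix x assume "x \<in> - K"
    then have "x \<in> ball x (infdist x K / 2)" "ball x (infdist x K / 2) \<in> \<B>"
      using pos[of x] by (auto simp: \<B>_def)
    then show "x \<in> \<Union>\<B>" by blast
  qed
  have \<B>_open: "open B" if "B \<in> \<B>" for B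
    using that by (auto simp: \<B>_def)
  obtain \<C> where cover: "- K \<subseteq> \<Union>\<C>"
    and refine: "\<And>W. W \<in> \<C> \<Longrightarrow> open W \<and> (\<exists>B. B \<in> \<B> \<and> W \<subseteq> B)"
    and fin: "\<And>x. x \<in> - K \<Longrightarrow> \<exists>V. open V \<and> x \<in> V \<and> finite {W \<in> \<C>. W \<inter> V \<noteq> {}}"
    by (rule paracompact[OF \<B>_cover \<B>_open]) (assumption, rule that)
  have "\<exists>a\<in>K. \<forall>x\<in>W. dist x a \<le> 4 * infdist x K" if W: "W \<in> \<C>" for W
  proof -
    obtain v where v: "v \<notin> K" "W \<subseteq> ball v (infdist v K / 2)"
      using refine[OF W] by (auto simp: \<B>_def)
    obtain a where a: "a \<in> K" "dist v a < 3/2 * infdist v K"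
    proof -
      have "(INF a\<in>K. dist v a) < 3/2 * infdist v K"
        using pos[OF v(1)] infdist_notempty[OF assms(2), of v] by simp
      then show ?thesis
        using that assms(2) by (subst (asm) cInf_less_iff) auto
    qed
    \<comment> \<open>With \<open>r = infdist v K\<close>: \<open>dist x a < r / 2 + 3/2 * r = 2 * r\<close>, and \<open>r < 2 * infdist x K\<close>.\<close>
    have "dist x a \<le> 4 * infdist x K" if "x \<in> W" for x
    proof -
      have "dist v x < infdist v K / 2"
        using v(2) that by auto
      moreover have "infdist v K \<le> infdist x K + dist v x"
        by (rule infdist_triangle)
      moreover have "dist x a \<le> dist v x + dist v a"
        by (metis dist_commute dist_triangle)
      ultimately show ?thesis
        using a(2) pos[OF v(1)] by linarith
    qed
    with a(1) show ?thesis by blast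
  qed
  then obtain A where A: "\<And>W. W \<in> \<C> \<Longrightarrow> A W \<in> K"
      "\<And>W x. W \<in> \<C> \<Longrightarrow> x \<in> W \<Longrightarrow> dist x (A W) \<le> 4 * infdist x K"
    by metis
  have open_\<C>: "open W" if "W \<in> \<C>" for W
    using refine[OF that] by blast
  obtain H :: "'a set \<Rightarrow> 'a \<Rightarrow> real"
    where H: "\<And>W. W \<in> \<C> \<Longrightarrow> continuous_on (- K) (H W) \<and> (\<forall>x\<in>- K. 0 \<le> H W x)"
      "\<And>x W. W \<in> \<C> \<Longrightarrow> x \<in> - K \<Longrightarrow> x \<notin> W \<Longrightarrow> H W x = 0"
      "\<And>x. x \<in> - K \<Longrightarrow> supp_sum (\<lambda>W. H W x) \<C> = 1"
      "\<And>x. x \<in> - K \<Longrightarrow> \<exists>V. open V \<and> x \<in> V \<and> finite {W \<in> \<C>. \<exists>y\<in>V. H W y \<noteq> 0}"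
    by (rule subordinate_partition_of_unity[OF cover open_\<C> fin]) (assumption, assumption, rule that)
  show thesis
  proof (rule that[of \<C> H A])
    show "dist x (A W) \<le> 4 * infdist x K" if "W \<in> \<C>" "x \<notin> K" "H W x \<noteq> 0" for W x
      using A(2)[OF that(1)] H(2)[OF that(1), of x] that(2,3) by blast
  qed (use A(1) H in simp_all)
qed

text \<open>Off \<open>K\<close> the extension is locally a finite sum of continuous functions. At \<open>a \<in> K\<close> every
  relevant point \<open>A W\<close> lies within \<open>5 * dist y a\<close> of \<open>a\<close>, since
  \<open>dist y (A W) \<le> 4 * infdist y K \<le> 4 * dist y a\<close>; hence \<open>T y\<close> is a convex combination of values of
  \<open>f\<close> near \<open>f a\<close>.\<close>

theorem Dugundji_locally_convex:
  fixes f :: "'a::{metric_space,second_countable_topology} \<Rightarrow> 'l::locally_convex_space"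
  assumes "closed K" "K \<noteq> {}" "continuous_on K f"
  obtains T where "continuous_on UNIV T" "\<And>x. x \<in> K \<Longrightarrow> T x = f x"
    "range T \<subseteq> convex hull (f ` K)"
proof -
  obtain \<C> :: "'a set set" and H :: "'a set \<Rightarrow> 'a \<Rightarrow> real" and A :: "'a set \<Rightarrow> 'a"
    where H_cont: "\<And>W. W \<in> \<C> \<Longrightarrow> continuous_on (- K) (H W)"
    and H_nonneg: "\<And>W x. W \<in> \<C> \<Longrightarrow> x \<notin> K \<Longrightarrow> 0 \<le> H W x"
    and H_sum: "\<And>x. x \<notin> K \<Longrightarrow> supp_sum (\<lambda>W. H W x) \<C> = 1"
    and H_fin: "\<And>x. x \<notin> K \<Longrightarrow> \<exists>V. open V \<and> x \<in> V \<and> finite {W \<in> \<C>. \<exists>y\<in>V. H W y \<noteq> 0}"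
    and A_in: "\<And>W. W \<in> \<C> \<Longrightarrow> A W \<in> K"
    and A_near: "\<And>W x. W \<in> \<C> \<Longrightarrow> x \<notin> K \<Longrightarrow> H W x \<noteq> 0 \<Longrightarrow> dist x (A W) \<le> 4 * infdist x K"
    by (rule Dugundji_partition_of_unity[OF assms(1,2)]) (rule that)
  define T where "T x = (if x \<in> K then f x else supp_sum (\<lambda>W. H W x *\<^sub>R f (A W)) \<C>)" for x
  \<comment> \<open>Used twice: with a neighbourhood of \<open>f a\<close> for continuity, and with the convex hull for the
    range.\<close>
  have T_in_convex: "T x \<in> C"
    if "convex C" "x \<notin> K" "\<And>W. W \<in> \<C> \<Longrightarrow> H W x \<noteq> 0 \<Longrightarrow> f (A W) \<in> C" for C x
    using convex_supp_sum[OF that(1) H_sum[OF that(2)], of "\<lambda>W. f (A W)"]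
      that H_nonneg by (auto simp: T_def)
  have cont_off: "continuous (at x) T" if x: "x \<notin> K" for x
  proof -
    obtain V where V: "open V" "x \<in> V" "finite {W \<in> \<C>. \<exists>y\<in>V. H W y \<noteq> 0}"
      using H_fin[OF x] by blast
    let ?J = "{W \<in> \<C>. \<exists>y\<in>V. H W y \<noteq> 0}"
    have T_sum: "T y = (\<Sum>W\<in>?J. H W y *\<^sub>R f (A W))" if "y \<in> V - K" for y
    proof -
      have "T y = supp_sum (\<lambda>W. H W y *\<^sub>R f (A W)) \<C>"
        using that by (simp add: T_def)
      also have "\<dots> = (\<Sum>W\<in>?J. H W y *\<^sub>R f (A W))"
        unfolding supp_sum_def support_on_def
        using that by (intro sum.mono_neutral_left V(3)) auto
      finally show ?thesis .
    qed
    have "continuous_on (V - K) (\<lambda>y. \<Sum>W\<in>?J. H W y *\<^sub>R f (A W))"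
      by (intro continuous_on_sum continuous_on_scaleR_topological_vector continuous_on_const)
         (auto intro: continuous_on_subset[OF H_cont])
    then have "continuous_on (V - K) T"
      by (rule continuous_on_eq) (simp only: T_sum)
    then show ?thesis
      using V(1,2) x assms(1) by (simp add: continuous_on_eq_continuous_at open_Diff)
  qed
  have cont_on: "continuous (at a) T" if a: "a \<in> K" for a
    unfolding continuous_at tendsto_def
  proof (intro allI impI)
    fix X :: "'l set" assume X: "open X" "T a \<in> X"
    have "open ((\<lambda>z. f a + z) -` X)"
      using X(1) by (intro open_vimage continuous_intros)
    then obtain C V where C: "convex C" "open V" "0 \<in> V" "V \<subseteq> C" "C \<subseteq> (\<lambda>z. f a + z) -` X"
      using convex_nhds_zero[of "(\<lambda>z. f a + z) -` X"] X a by (auto simp: T_def)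
    have conv: "convex ((\<lambda>z. f a + z) ` C)"
      using C(1) by (rule convex_translation)
    have "(f \<longlongrightarrow> f a) (at a within K)"
      using assms(3) a by (simp add: continuous_on_def)
    then have "((\<lambda>y. f y + - f a) \<longlongrightarrow> f a + - f a) (at a within K)"
      by (intro tendsto_add tendsto_const)
    then have "\<forall>\<^sub>F y in at a within K. f y + - f a \<in> V"
      using C(2,3) by (intro topological_tendstoD) auto
    then obtain \<delta> where \<delta>: "0 < \<delta>"
        "\<And>y. y \<in> K \<Longrightarrow> y \<noteq> a \<Longrightarrow> dist y a < \<delta> \<Longrightarrow> f y - f a \<in> V"
      by (auto simp: eventually_at)
    have near: "f y \<in> (\<lambda>z. f a + z) ` C" if "y \<in> K" "dist y a < \<delta>" for y
    proof (rule image_eqI)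
      show "f y - f a \<in> C"
        using \<delta>(2)[OF that(1) _ that(2)] C(3,4) by (cases "y = a") auto
    qed simp
    have "T y \<in> X" if y: "dist y a < \<delta> / 5" for y
    proof -
      have "T y \<in> (\<lambda>z. f a + z) ` C"
      proof (cases "y \<in> K")
        case True
        then show ?thesis
          using near[of y] y \<delta>(1) by (simp add: T_def)
      next
        case False
        show ?thesis
        proof (rule T_in_convex[OF conv False])
          fix W assume W: "W \<in> \<C>" "H W y \<noteq> 0"
          have "dist (A W) a \<le> dist y (A W) + dist y a"
            by (metis dist_commute dist_triangle)
          also have "\<dots> \<le> 4 * dist y a + dist y a"
            using A_near[OF W(1) False W(2)] infdist_le[OF a, of y] by linarith
          finally show "f (A W) \<in> (\<lambda>z. f a + z) ` C"
            using near[OF A_in[OF W(1)]] y by simp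
        qed
      qed
      then show ?thesis
        using C(5) by auto
    qed
    then show "\<forall>\<^sub>F y in at a. T y \<in> X"
      using \<delta>(1) by (auto simp: eventually_at intro!: exI[of _ "\<delta> / 5"])
  qed
  show thesis
  proof
    show "continuous_on UNIV T"
      using cont_off cont_on by (auto simp: continuous_on_eq_continuous_at)
    show "T x = f x" if "x \<in> K" for x
      using that by (simp add: T_def)
    have "T x \<in> convex hull (f ` K)" for x
    proof (cases "x \<in> K")
      case True
      then show ?thesis by (simp add: T_def hull_inc)
    next
      case False
      then show ?thesis
        by (intro T_in_convex) (auto intro: hull_inc A_in)
    qed
    then show "range T \<subseteq> convex hull (f ` K)" by blast
  qed
qed

section \<open>Closed range and factorization\<close>

text \<open>If \<open>f (x n)\<close> converges, coercivity bounds the sequence \<open>x\<close>; a limit of a convergent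
  subsequence is a preimage of the limit.\<close>

lemma closed_range_if_coercive:
  fixes f :: "'a::euclidean_space \<Rightarrow> 'b::metric_space"
  assumes "continuous_on UNIV f" "0 < a" "\<And>x. a * norm x \<le> dist (f x) (f 0)"
  shows "closed (range f)"
proof -
  have "l \<in> range f" if range: "\<forall>n. y n \<in> range f" and lim: "y \<longlonglongrightarrow> l" for y l
  proof -
    obtain x where y: "\<And>n. y n = f (x n)"
      using range unfolding image_iff by metis
    have "bounded (range y)"
      using lim by (rule convergent_imp_bounded)
    then obtain B where B: "\<And>n. dist (f 0) (y n) \<le> B"
      using bounded_any_center[of "range y" "f 0"] by auto
    have "norm (x n) \<le> B / a" for n
    proof -
      have "a * norm (x n) \<le> B"
        using assms(3)[of "x n"] B[of n] by (simp add: y dist_commute)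
      then show ?thesis
        using assms(2) by (simp add: field_simps)
    qed
    then have "bounded (range x)"
      by (auto intro: boundedI)
    then obtain x' r where r: "strict_mono r" "(x \<circ> r) \<longlonglongrightarrow> x'"
      using bounded_imp_convergent_subsequence by blast
    have "(\<lambda>n. f ((x \<circ> r) n)) \<longlonglongrightarrow> f x'"
      by (rule continuous_on_tendsto_compose[OF assms(1) r(2)]) auto
    moreover have "(\<lambda>n. f ((x \<circ> r) n)) \<longlonglongrightarrow> l"
      using LIMSEQ_subseq_LIMSEQ[OF lim r(1)] by (simp add: o_def y)
    ultimately have "l = f x'"
      using LIMSEQ_unique by blast
    then show ?thesis by blast
  qed
  then show ?thesis
    unfolding closed_sequential_limits by blast
qed

text \<open>The inverse of \<open>h\<close> on \<open>h ` M\<close> is well defined and Lipschitz with constant \<open>1 / a\<close>; \<open>f\<close> is its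
  composition with \<open>F\<close>.\<close>

lemma (in Metric_space) continuous_map_factor_through_expansive:
  fixes h :: "'a \<Rightarrow> 'c::metric_space" and F :: "'a \<Rightarrow> 'l::topological_space"
  assumes "0 < a" "\<And>A B. A \<in> M \<Longrightarrow> B \<in> M \<Longrightarrow> a * d A B \<le> dist (h A) (h B)"
    and "continuous_map mtopology euclidean F"
  obtains f where "continuous_on (h ` M) f" "\<And>A. A \<in> M \<Longrightarrow> f (h A) = F A"
proof
  have inj: "inj_on h M"
  proof (rule inj_onI)
    fix A B assume "A \<in> M" "B \<in> M" "h A = h B"
    then have "a * d A B \<le> 0" using assms(2)[of A B] by simp
    then have "d A B \<le> 0" using assms(1) by (simp add: mult_le_0_iff)
    then show "A = B" using \<open>A \<in> M\<close> \<open>B \<in> M\<close> nonneg[of A B] by auto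
  qed
  let ?f = "F \<circ> inv_into M h"
  show eq: "?f (h A) = F A" if "A \<in> M" for A
    using that inj by simp
  show "continuous_on (h ` M) ?f"
    unfolding continuous_on_def tendsto_def
  proof (intro ballI allI impI)
    fix y X assume "y \<in> h ` M" and X: "open X" "?f y \<in> X"
    then obtain A where A: "A \<in> M" "y = h A" by blast
    have "openin mtopology {B \<in> M. F B \<in> X}"
      using openin_continuous_map_preimage[OF assms(3), of X] X(1) by simp
    then obtain r where r: "0 < r" "mball A r \<subseteq> {B \<in> M. F B \<in> X}"
      using A X(2) eq[OF A(1)] unfolding openin_mtopology by auto
    have "?f (h B) \<in> X" if "B \<in> M" "dist (h B) (h A) < a * r" for B
    proof -
      have "a * d A B < a * r"
        using assms(2)[OF A(1) that(1)] that(2) by (simp add: dist_commute)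
      then have "B \<in> mball A r"
        using assms(1) A(1) that(1) by simp
      then show ?thesis
        using r(2) eq[OF that(1)] by auto
    qed
    then show "\<forall>\<^sub>F z in at y within h ` M. ?f z \<in> X"
      using assms(1) r(1) A(2) by (auto simp: eventually_at intro!: exI[of _ "a * r"])
  qed
qed

section \<open>Extension of invariant maps through the coorbit embedding\<close>

lemma quotient_dist_orbit_le:
  fixes G (structure)
  assumes "unitary_action G U" "finite (carrier G)"
  shows "quotient_dist G U (orbit G U x) (orbit G U y) \<le> dist x y"
proof -
  interpret group G using assms by (simp add: unitary_action_def)
  have "(MIN g\<in>carrier G. norm (x - U g y)) \<le> norm (x - U \<one> y)"
    using assms(2) by (intro Min_le) auto
  then show ?thesis
    by (simp add: quotient_dist_orbit[OF assms(1)] unitary_action_one[OF assms(1)] dist_norm)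
qed

lemma quotient_dist_orbit_0:
  fixes G (structure)
  assumes "unitary_action G U"
  shows "quotient_dist G U (orbit G U x) (orbit G U 0) = norm x"
proof -
  interpret group G using assms by (simp add: unitary_action_def)
  have "(\<lambda>g. norm (x - U g 0)) ` carrier G = {norm x}"
    using linear_0[OF unitary_actionD(2)[OF assms]] one_closed
    by (intro image_eq_singletonI) auto
  then show ?thesis
    by (simp add: quotient_dist_orbit[OF assms])
qed

theorem theorem1p8:
  fixes G :: "('g, 'b) monoid_scheme"
    and U :: "'g \<Rightarrow> 'v::euclidean_space \<Rightarrow> 'v"
    and p :: nat
    and S :: "(nat \<times> nat) set"
    and w :: "nat \<Rightarrow> 'v"
    and e :: "'m::finite \<Rightarrow> nat \<times> nat"
    and F :: "'v set \<Rightarrow> 'l::locally_convex_space"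
  assumes "DIM('v) \<ge> 2"
    and "finite (carrier G)"
    and "unitary_action G U"
    and "S \<subseteq> {1..order G} \<times> {1..p}"
    and "bij_betw e UNIV S"
    and "bi_lipschitz_on (quotient_space G U) (quotient_dist G U) (coorbit_quotient G U w e)"
    and "continuous_map (quotient_topology G U) euclidean F"
  shows "\<exists>T :: real ^ 'm \<Rightarrow> 'l.
           continuous_on UNIV T \<and>
           (\<forall>x. F (orbit G U x) = T (coorbit G U w e x)) \<and>
           range T \<subseteq> convex hull (F ` quotient_space G U)"
proof -
  let ?\<Phi> = "coorbit G U w e" and ?h = "coorbit_quotient G U w e"
  let ?d = "quotient_dist G U"
  interpret Metric_space "quotient_space G U" ?d
    using assms(3,2) by (rule Metric_space_quotient)
  have orb: "orbit G U x \<in> quotient_space G U" for x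
    by (auto simp: orbits_def)
  have h_orbit: "?h (orbit G U x) = ?\<Phi> x" for x
    by (rule coorbit_quotient_orbit[OF assms(3)])
  have range_\<Phi>: "?h ` quotient_space G U = range ?\<Phi>"
  proof -
    have "quotient_space G U = range (orbit G U)"
      by (auto simp: orbits_def)
    then show ?thesis by (simp add: image_image h_orbit)
  qed
  obtain a b where "0 < a" "a \<le> b"
    and lower: "\<And>A B. A \<in> quotient_space G U \<Longrightarrow> B \<in> quotient_space G U \<Longrightarrow>
                  a * ?d A B \<le> dist (?h A) (?h B)"
    and upper: "\<And>A B. A \<in> quotient_space G U \<Longrightarrow> B \<in> quotient_space G U \<Longrightarrow>
                  dist (?h A) (?h B) \<le> b * ?d A B"
    using assms(6) unfolding bi_lipschitz_on_def by blast
  have "dist (?\<Phi> x) (?\<Phi> y) \<le> b * dist x y" for x y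
  proof -
    have "dist (?\<Phi> x) (?\<Phi> y) \<le> b * ?d (orbit G U x) (orbit G U y)"
      using upper[OF orb orb, of x y] by (simp add: h_orbit)
    also have "\<dots> \<le> b * dist x y"
      using quotient_dist_orbit_le[OF assms(3,2)] \<open>0 < a\<close> \<open>a \<le> b\<close>
      by (intro mult_left_mono) auto
    finally show ?thesis .
  qed
  then have "b-lipschitz_on UNIV ?\<Phi>"
    using \<open>0 < a\<close> \<open>a \<le> b\<close> by (intro lipschitz_onI) auto
  then have "continuous_on UNIV ?\<Phi>"
    by (rule lipschitz_on_continuous_on)
  moreover have "a * norm x \<le> dist (?\<Phi> x) (?\<Phi> 0)" for x
    using lower[OF orb orb, of x 0] by (simp add: h_orbit quotient_dist_orbit_0[OF assms(3)])
  ultimately have "closed (range ?\<Phi>)"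
    using \<open>0 < a\<close> by (intro closed_range_if_coercive)
  obtain f where f: "continuous_on (range ?\<Phi>) f"
      "\<And>A. A \<in> quotient_space G U \<Longrightarrow> f (?h A) = F A"
    using continuous_map_factor_through_expansive[OF \<open>0 < a\<close> lower
        assms(7)[unfolded quotient_topology_def]]
    unfolding range_\<Phi> by blast
  have f_\<Phi>: "f (?\<Phi> x) = F (orbit G U x)" for x
    using f(2)[OF orb, of x] by (simp add: h_orbit)
  obtain T where T: "continuous_on UNIV T" "\<And>y. y \<in> range ?\<Phi> \<Longrightarrow> T y = f y"
      "range T \<subseteq> convex hull (f ` range ?\<Phi>)"
    using Dugundji_locally_convex[OF \<open>closed (range ?\<Phi>)\<close> _ f(1)] by blast
  have "f ` range ?\<Phi> = F ` quotient_space G U"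
    unfolding range_\<Phi>[symmetric] image_image using f(2) by (intro image_cong) auto
  with T f_\<Phi> show ?thesis
    by (intro exI[of _ T]) auto
qed

end
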